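(* If the boundary condition is periodic or the solution has compact support, then the three-dimensional CT scheme given in the context satisfies the energy conservation identity $$\sum_{i,j,k}\left(\frac12\rho^n_{ijk}|\bm v^n_{ijk}|^2+\frac12|\bm B^n_{ijk}|^2\right)=\sum_{i,j,k}\left(\frac12\rho^{n+1}_{ijk}|\bm v^{n+1}_{ijk}|^2+\frac12|\bm B^{n+1}_{ijk}|^2\right).$$
   Context: Uniform 3D grid with spacings $\Delta x,\Delta y,\Delta z>0$, time step $\Delta t>0$. Either indices $(i,j,k)$ are taken periodically and sums run over one period, or (compact support) the grid is $\mathbb Z^3$ and $\bm B,\bm v$ at both time levels vanish outside a finite set of cells. $\bm B_{ijk}=(B^x,B^y,B^z)^\top_{ijk}$, $\bm v_{ijk}=(v^x,v^y,v^z)^\top_{ijk}\in\mathbb R^3$, $\rho^{n+1}_{ijk}=\rho^n_{ijk}>0$ (density is unchanged in this step). Set $\bm B^{n+\frac12}_{ijk}=\frac12(\bm B^n_{ijk}+\bm B^{n+1}_{ijk})$, $\bm v^{n+\frac12}_{ijk}=\frac12(\bm v^n_{ijk}+\bm v^{n+1}_{ijk})$, $\mathbf\Omega^{n+\frac12}_{ijk}=\bm B^{n+\frac12}_{ijk}\times\bm v^{n+\frac12}_{ijk}=(\Omega^x,\Omega^y,\Omega^z)^{n+\frac12}_{ijk}$. For a grid function $f$: $D_xf_{ijk}=\frac{f_{i+1,j,k}-f_{i-1,j,k}}{2\Delta x}$, $D_yf_{ijk}=\frac{f_{i,j+1,k}-f_{i,j-1,k}}{2\Delta y}$, $D_zf_{ijk}=\frac{f_{i,j,k+1}-f_{i,j,k-1}}{2\Delta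 z}$. The (implicit) CT scheme is, at every $(i,j,k)$, $$B^{x,n+1}=B^{x,n}-\Delta t\,D_y\Omega^{z,n+\frac12}+\Delta t\,D_z\Omega^{y,n+\frac12},\quad B^{y,n+1}=B^{y,n}+\Delta t\,D_x\Omega^{z,n+\frac12}-\Delta t\,D_z\Omega^{x,n+\frac12},$$ $$B^{z,n+1}=B^{z,n}-\Delta t\,D_x\Omega^{y,n+\frac12}+\Delta t\,D_y\Omega^{x,n+\frac12},\quad \rho^n\bm v^{n+1}=\rho^n\bm v^n-\Delta t\,\bm B^{n+\frac12}\times\operatorname{curl}\bm B^{n+\frac12},$$ with $\operatorname{curl}\bm B=(D_yB^z-D_zB^y,\ D_zB^x-D_xB^z,\ D_xB^y-D_yB^x)^\top$. *)

theory Defs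
  imports "HOL-Analysis.Analysis"
begin

type_synonym 'a grid_fun = "int \<Rightarrow> int \<Rightarrow> int \<Rightarrow> 'a"

definition Dx :: "real \<Rightarrow> real grid_fun \<Rightarrow> real grid_fun" where
  "Dx dx f i j k = (f (i + 1) j k - f (i - 1) j k) / (2 * dx)"

definition Dy :: "real \<Rightarrow> real grid_fun \<Rightarrow> real grid_fun" where
  "Dy dy f i j k = (f i (j + 1) k - f i (j - 1) k) / (2 * dy)"

definition Dz :: "real \<Rightarrow> real grid_fun \<Rightarrow> real grid_fun" where
  "Dz dz f i j k = (f i j (k + 1) - f i j (k - 1)) / (2 * dz)"

definition grid_component :: "3 \<Rightarrow> (real^3) grid_fun \<Rightarrow> real grid_fun" where
  "grid_component a F i j k = F i j k $ a"

definition grid_curl :: "real \<Rightarrow> real \<Rightarrow> real \<Rightarrow> (real^3) grid_fun \<Rightarrow> (real^3) grid_fun" where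
  "grid_curl dx dy dz B i j k = vector
     [Dy dy (grid_component 3 B) i j k - Dz dz (grid_component 2 B) i j k,
      Dz dz (grid_component 1 B) i j k - Dx dx (grid_component 3 B) i j k,
      Dx dx (grid_component 2 B) i j k - Dy dy (grid_component 1 B) i j k]"

text \<open>The value at time level n + 1/2, from those at levels n and n + 1.\<close>

definition midpt :: "(real^3) grid_fun \<Rightarrow> (real^3) grid_fun \<Rightarrow> (real^3) grid_fun" where
  "midpt F0 F1 i j k = (1/2) *\<^sub>R (F0 i j k + F1 i j k)"

definition grid_cross :: "(real^3) grid_fun \<Rightarrow> (real^3) grid_fun \<Rightarrow> (real^3) grid_fun" where
  "grid_cross F G i j k = cross3 (F i j k) (G i j k)"

text \<open>Suffixes 0 and 1 denote time levels n and n + 1. The scheme is implicit, so it is a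
  relation between the two levels; \<open>rho\<close> is the density at level n.\<close>

definition ct_scheme ::
  "real \<Rightarrow> real \<Rightarrow> real \<Rightarrow> real \<Rightarrow> real grid_fun \<Rightarrow> (real^3) grid_fun \<Rightarrow> (real^3) grid_fun \<Rightarrow>
   (real^3) grid_fun \<Rightarrow> (real^3) grid_fun \<Rightarrow> bool" where
  "ct_scheme dx dy dz dt rho B0 v0 B1 v1 \<longleftrightarrow>
    (let Bh = midpt B0 B1; Om = grid_cross Bh (midpt v0 v1) in
     \<forall>i j k.
      B1 i j k $ 1 = B0 i j k $ 1 - dt * Dy dy (grid_component 3 Om) i j k + dt * Dz dz (grid_component 2 Om) i j k \<and>
      B1 i j k $ 2 = B0 i j k $ 2 + dt * Dx dx (grid_component 3 Om) i j k - dt * Dz dz (grid_component 1 Om) i j k \<and>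
      B1 i j k $ 3 = B0 i j k $ 3 - dt * Dx dx (grid_component 2 Om) i j k + dt * Dy dy (grid_component 1 Om) i j k \<and>
      rho i j k *\<^sub>R v1 i j k =
        rho i j k *\<^sub>R v0 i j k - dt *\<^sub>R grid_cross Bh (grid_curl dx dy dz Bh) i j k)"

definition energy_density ::
  "real grid_fun \<Rightarrow> (real^3) grid_fun \<Rightarrow> (real^3) grid_fun \<Rightarrow> real grid_fun" where
  "energy_density rho B v i j k =
     1/2 * rho i j k * (norm (v i j k))\<^sup>2 + 1/2 * (norm (B i j k))\<^sup>2"

definition grid_periodic :: "int \<Rightarrow> int \<Rightarrow> int \<Rightarrow> 'a grid_fun \<Rightarrow> bool" where
  "grid_periodic Nx Ny Nz f \<longleftrightarrow>
     (\<forall>i j k. f (i + Nx) j k = f i j k \<and> f i (j + Ny) k = f i j k \<and> f i j (k + Nz) = f i j k)"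

definition grid_compact_support :: "'a::zero grid_fun \<Rightarrow> bool" where
  "grid_compact_support f \<longleftrightarrow> finite {(i, j, k). f i j k \<noteq> 0}"

end

theory Submission
  imports Defs
begin

text \<open>
  Testing the update against the midpoint values turns the energy increment of a cell into
  \<open>dt (curl B \<bullet> \<Omega> - B \<bullet> curl \<Omega>)\<close>, a discrete divergence of \<open>B \<times> \<Omega>\<close>: the central difference
  satisfies \<open>f\<^sub>i (D g)\<^sub>i + g\<^sub>i (D f)\<^sub>i = (H\<^sub>i\<^sub>+\<^sub>1 - H\<^sub>i) / (2 dx)\<close> exactly, with the interface value
  \<open>H\<^sub>i = f\<^sub>i\<^sub>-\<^sub>1 g\<^sub>i + f\<^sub>i g\<^sub>i\<^sub>-\<^sub>1\<close>. Shift invariance of the sum then makes the fluxes cancel.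
\<close>

text \<open>The flux through the interface between a cell and its neighbour at offset \<open>- (a, b, c)\<close>;
  symmetrising over the two cells is what the central difference calls for.\<close>

definition interface_flux ::
  "int \<Rightarrow> int \<Rightarrow> int \<Rightarrow> (real^3) grid_fun \<Rightarrow> (real^3) grid_fun \<Rightarrow> (real^3) grid_fun" where
  "interface_flux a b c F G i j k =
     cross3 (F (i - a) (j - b) (k - c)) (G i j k) + cross3 (F i j k) (G (i - a) (j - b) (k - c))"

text \<open>The discrete counterpart of div(F x G) = curl F . G - F . curl G. Every product on
  either side pairs a value in the cell with one in a neighbour, so the sides match term by term.
  The interface flux adds two such products without halving them, hence \<open>2 * dx\<close> under
  a one-cell difference.\<close>

lemma curl_inner_diff:
  assumes "dx \<noteq> 0" "dy \<noteq> 0" "dz \<noteq> 0"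
  shows "grid_curl dx dy dz F i j k \<bullet> G i j k - F i j k \<bullet> grid_curl dx dy dz G i j k =
    (interface_flux 1 0 0 F G (i + 1) j k - interface_flux 1 0 0 F G i j k) $ 1 / (2 * dx) +
    (interface_flux 0 1 0 F G i (j + 1) k - interface_flux 0 1 0 F G i j k) $ 2 / (2 * dy) +
    (interface_flux 0 0 1 F G i j (k + 1) - interface_flux 0 0 1 F G i j k) $ 3 / (2 * dz)"
  using assms
  by (simp add: grid_curl_def Dx_def Dy_def Dz_def grid_component_def interface_flux_def
      inner_vec_def sum_3 cross3_def diff_divide_distrib add_divide_distrib algebra_simps)

text \<open>Half-level test vectors leave no remainder in \<open>dt\<close>, because a difference of
  squares is twice the increment times the mean. The density is the same at both levels, so it is a
  common weight in the kinetic part.\<close>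

lemma ct_scheme_energy_increment:
  assumes "ct_scheme dx dy dz dt rho B0 v0 B1 v1"
  defines "Bh \<equiv> midpt B0 B1"
  defines "Om \<equiv> grid_cross Bh (midpt v0 v1)"
  shows "energy_density rho B1 v1 i j k - energy_density rho B0 v0 i j k =
    dt * (grid_curl dx dy dz Bh i j k \<bullet> Om i j k - Bh i j k \<bullet> grid_curl dx dy dz Om i j k)"
proof -
  define Vh where "Vh = midpt v0 v1"
  have B: "B1 i j k - B0 i j k = - dt *\<^sub>R grid_curl dx dy dz Om i j k"
    using assms(1) unfolding ct_scheme_def Let_def Bh_def[symmetric] Om_def[symmetric]
    by (simp add: vec_eq_iff forall_3 grid_curl_def algebra_simps)
  have v: "rho i j k *\<^sub>R (v1 i j k - v0 i j k) =
      - dt *\<^sub>R cross3 (Bh i j k) (grid_curl dx dy dz Bh i j k)"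
    using assms(1) unfolding ct_scheme_def Let_def Bh_def[symmetric]
    by (simp add: grid_cross_def scaleR_diff_right)
  have polar: "(norm y)\<^sup>2 - (norm x)\<^sup>2 = 2 * ((y - x) \<bullet> ((1/2) *\<^sub>R (x + y)))" for x y :: "real^3"
    by (simp add: power2_norm_eq_inner algebra_simps inner_commute)
  have "energy_density rho B1 v1 i j k - energy_density rho B0 v0 i j k =
      1/2 * rho i j k * ((norm (v1 i j k))\<^sup>2 - (norm (v0 i j k))\<^sup>2) +
      1/2 * ((norm (B1 i j k))\<^sup>2 - (norm (B0 i j k))\<^sup>2)"
    by (simp add: energy_density_def algebra_simps)
  also have "\<dots> = (rho i j k *\<^sub>R (v1 i j k - v0 i j k)) \<bullet> Vh i j k +
      (B1 i j k - B0 i j k) \<bullet> Bh i j k"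
    unfolding polar by (simp add: Vh_def Bh_def midpt_def)
  also have "\<dots> = - dt * (cross3 (Bh i j k) (grid_curl dx dy dz Bh i j k) \<bullet> Vh i j k)
      - dt * (Bh i j k \<bullet> grid_curl dx dy dz Om i j k)"
    unfolding v B by (simp add: inner_commute)
  \<comment> \<open>Swapping two factors of a scalar triple product flips its sign. Since
    \<open>Om\<close> is built from the same \<open>Bh\<close> and \<open>Vh\<close>, the work of
    the magnetic force becomes the partner of the induction term.\<close>
  also have "cross3 (Bh i j k) (grid_curl dx dy dz Bh i j k) \<bullet> Vh i j k =
      - (grid_curl dx dy dz Bh i j k \<bullet> Om i j k)"
    unfolding Om_def Vh_def[symmetric] grid_cross_def
    by (simp add: cross3_def inner_vec_def sum_3 algebra_simps)
  finally show ?thesis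
    by (simp add: algebra_simps)
qed

lemma sum_forward_difference_int:
  fixes f :: "int \<Rightarrow> 'a::ab_group_add"
  assumes "0 \<le> N"
  shows "(\<Sum>i\<in>{0..<N}. f (i + 1) - f i) = f N - f 0"
  using assms
proof (induction N rule: int_ge_induct)
  case (step N)
  moreover have "{0..<N + 1} = insert N {0..<N}" using step.hyps by auto
  ultimately show ?case by simp
qed simp

lemma grid_periodic_map2:
  assumes "grid_periodic Nx Ny Nz F" "grid_periodic Nx Ny Nz G"
  shows "grid_periodic Nx Ny Nz (\<lambda>i j k. h (F i j k) (G i j k))"
  using assms by (simp add: grid_periodic_def)

lemma grid_periodic_shift:
  assumes "grid_periodic Nx Ny Nz F"
  shows "grid_periodic Nx Ny Nz (\<lambda>i j k. F (i - a) (j - b) (k - c))"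
  using assms by (simp only: grid_periodic_def diff_add_eq[symmetric] simp_thms)

lemma grid_periodic_interface_flux:
  assumes "grid_periodic Nx Ny Nz F" "grid_periodic Nx Ny Nz G"
  shows "grid_periodic Nx Ny Nz (interface_flux a b c F G)"
proof -
  note shifted = assms[THEN grid_periodic_shift, of a b c]
  show ?thesis
    unfolding interface_flux_def[abs_def]
    by (intro grid_periodic_map2[where h = "(+)"] grid_periodic_map2[where h = cross3] assms shifted)
qed

text \<open>Each flux is differenced along its own axis only, so its sum telescopes there to the
  values at the two ends of the period, which periodicity identifies.\<close>

lemma sum_periodic_divergence:
  fixes X Y Z :: "'a::ab_group_add grid_fun"
  assumes "0 \<le> Nx" "0 \<le> Ny" "0 \<le> Nz"
    and "grid_periodic Nx Ny Nz X" "grid_periodic Nx Ny Nz Y" "grid_periodic Nx Ny Nz Z"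
  shows "(\<Sum>i\<in>{0..<Nx}. \<Sum>j\<in>{0..<Ny}. \<Sum>k\<in>{0..<Nz}.
      (X (i + 1) j k - X i j k) + (Y i (j + 1) k - Y i j k) + (Z i j (k + 1) - Z i j k)) = 0"
proof -
  have wrap: "X Nx j k = X 0 j k" "Y i Ny k = Y i 0 k" "Z i j Nz = Z i j 0" for i j k
    using assms(4-6) unfolding grid_periodic_def by (metis add_0)+
  have loop: "(\<Sum>i\<in>{0..<Nx}. X (i + 1) j k - X i j k) = 0"
    "(\<Sum>j\<in>{0..<Ny}. Y i (j + 1) k - Y i j k) = 0"
    "(\<Sum>k\<in>{0..<Nz}. Z i j (k + 1) - Z i j k) = 0" for i j k
    using assms(1-3) sum_forward_difference_int[of Nx "\<lambda>i. X i j k"]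
      sum_forward_difference_int[of Ny "\<lambda>j. Y i j k"]
      sum_forward_difference_int[of Nz "Z i j"]
    by (simp_all add: wrap)
  \<comment> \<open>The telescoping index has to be innermost. Fixing \<open>A\<close> in
    \<open>sum.swap\<close> lets the \<open>i\<close> sum move inwards only; for \<open>Z\<close>
    the order already fits.\<close>
  have "(\<Sum>i\<in>{0..<Nx}. \<Sum>j\<in>{0..<Ny}. \<Sum>k\<in>{0..<Nz}. X (i + 1) j k - X i j k) =
      (\<Sum>j\<in>{0..<Ny}. \<Sum>k\<in>{0..<Nz}. \<Sum>i\<in>{0..<Nx}. X (i + 1) j k - X i j k)"
    by (simp only: sum.swap[where A = "{0..<Nx}"])
  moreover have "(\<Sum>j\<in>{0..<Ny}. \<Sum>k\<in>{0..<Nz}. Y i (j + 1) k - Y i j k) =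
      (\<Sum>k\<in>{0..<Nz}. \<Sum>j\<in>{0..<Ny}. Y i (j + 1) k - Y i j k)" for i
    by (rule sum.swap)
  ultimately show ?thesis
    by (simp add: sum.distrib loop)
qed

lemma grid_compact_support_map2:
  assumes "grid_compact_support F" "grid_compact_support G" "h 0 0 = 0"
  shows "grid_compact_support (\<lambda>i j k. h (F i j k) (G i j k))"
proof -
  have "{(i, j, k). h (F i j k) (G i j k) \<noteq> 0} \<subseteq>
      {(i, j, k). F i j k \<noteq> 0} \<union> {(i, j, k). G i j k \<noteq> 0}"
    using assms(3) by auto
  then show ?thesis
    using assms(1,2) unfolding grid_compact_support_def by (meson finite_UnI finite_subset)
qed

lemma grid_compact_support_shift:
  assumes "grid_compact_support F"
  shows "grid_compact_support (\<lambda>i j k. F (i - a) (j - b) (k - c))"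
proof -
  have "{(i, j, k). F (i - a) (j - b) (k - c) \<noteq> 0} \<subseteq>
      (\<lambda>(i, j, k). (i + a, j + b, k + c)) ` {(i, j, k). F i j k \<noteq> 0}"
    by (force simp: image_iff)
  then show ?thesis
    using assms unfolding grid_compact_support_def by (meson finite_imageI finite_subset)
qed

lemma grid_compact_support_interface_flux:
  assumes "grid_compact_support F" "grid_compact_support G"
  shows "grid_compact_support (interface_flux a b c F G)"
proof -
  note shifted = assms[THEN grid_compact_support_shift, of a b c]
  show ?thesis
    unfolding interface_flux_def[abs_def]
    by (intro grid_compact_support_map2[where h = "(+)"]
        grid_compact_support_map2[where h = cross3] assms shifted) simp_all
qed

text \<open>An infinite sum defaults to 0 on a family that is not summable, so summability is what
  gives the total energy its intended meaning. The sum over the finite support extends by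
  zeros.\<close>

lemma grid_compact_support_summable:
  fixes f :: "'a::{comm_monoid_add,topological_space} grid_fun"
  assumes "grid_compact_support f"
  shows "(\<lambda>(i, j, k). f i j k) summable_on UNIV"
proof -
  have "(\<lambda>(i, j, k). f i j k) summable_on {(i, j, k). f i j k \<noteq> 0}"
    using assms by (simp add: grid_compact_support_def)
  then show ?thesis
    by (rule summable_on_cong_neutral[THEN iffD1, rotated -1]) auto
qed

text \<open>On the infinite grid a translation permutes the cells, so a function and its translate
  have the same sum; this replaces telescoping.\<close>

lemma has_sum_shift_difference:
  fixes f :: "real grid_fun"
  assumes "grid_compact_support f"
  shows "((\<lambda>(i, j, k). f (i + a) (j + b) (k + c) - f i j k) has_sum 0) UNIV"
proof -
  let ?f = "\<lambda>(i, j, k). f i j k"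
  obtain S where S: "(?f has_sum S) UNIV"
    using grid_compact_support_summable[OF assms] by (auto simp: summable_on_def)
  have "bij_betw (\<lambda>(i, j, k). (i + a, j + b, k + c)) UNIV (UNIV :: (int \<times> int \<times> int) set)"
    by (rule bij_betwI[where g = "\<lambda>(i, j, k). (i - a, j - b, k - c)"]) auto
  from has_sum_reindex_bij_betw[OF this, of ?f S] S
  have "((\<lambda>(i, j, k). f (i + a) (j + b) (k + c)) has_sum S) UNIV"
    by (simp add: case_prod_unfold)
  moreover have "((\<lambda>x. - ?f x) has_sum - S) UNIV"
    using S by (simp add: has_sum_uminus)
  ultimately have "((\<lambda>x. (\<lambda>(i, j, k). f (i + a) (j + b) (k + c)) x + - ?f x) has_sum S + - S) UNIV"
    by (rule has_sum_add)
  then show ?thesis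
    by (simp add: case_prod_unfold)
qed

theorem theorem4p3:
  fixes dx dy dz dt :: real
    and rho0 rho1 :: "real grid_fun"
    and B0 B1 v0 v1 :: "(real^3) grid_fun"
  assumes "dx > 0" and "dy > 0" and "dz > 0" and "dt > 0"
    and "\<And>i j k. rho0 i j k > 0"
    and "\<And>i j k. rho1 i j k = rho0 i j k"
    and "ct_scheme dx dy dz dt rho0 B0 v0 B1 v1"
  shows "(\<forall>Nx Ny Nz :: int. Nx > 0 \<and> Ny > 0 \<and> Nz > 0 \<and>
            grid_periodic Nx Ny Nz rho0 \<and> grid_periodic Nx Ny Nz rho1 \<and>
            grid_periodic Nx Ny Nz B0 \<and> grid_periodic Nx Ny Nz B1 \<and>
            grid_periodic Nx Ny Nz v0 \<and> grid_periodic Nx Ny Nz v1 \<longrightarrow>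
            (\<Sum>i\<in>{0..<Nx}. \<Sum>j\<in>{0..<Ny}. \<Sum>k\<in>{0..<Nz}. energy_density rho0 B0 v0 i j k) =
            (\<Sum>i\<in>{0..<Nx}. \<Sum>j\<in>{0..<Ny}. \<Sum>k\<in>{0..<Nz}. energy_density rho1 B1 v1 i j k))
       \<and> (grid_compact_support B0 \<and> grid_compact_support B1 \<and>
            grid_compact_support v0 \<and> grid_compact_support v1 \<longrightarrow>
            (\<Sum>\<^sub>\<infinity>(i, j, k)\<in>UNIV. energy_density rho0 B0 v0 i j k) =
            (\<Sum>\<^sub>\<infinity>(i, j, k)\<in>UNIV. energy_density rho1 B1 v1 i j k))"
proof -
  define Bh where "Bh = midpt B0 B1"
  define Om where "Om = grid_cross Bh (midpt v0 v1)"
  \<comment> \<open>The constants \<open>dt\<close> and \<open>1 / (2 * dx)\<close> go into the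
    flux, leaving the bare differences that both summation lemmas handle.\<close>
  define X where "X i j k = dt / (2 * dx) * interface_flux 1 0 0 Bh Om i j k $ 1" for i j k
  define Y where "Y i j k = dt / (2 * dy) * interface_flux 0 1 0 Bh Om i j k $ 2" for i j k
  define Z where "Z i j k = dt / (2 * dz) * interface_flux 0 0 1 Bh Om i j k $ 3" for i j k
  note flux_defs = X_def[abs_def] Y_def[abs_def] Z_def[abs_def]
  have rho: "rho1 = rho0"
    using assms(6) by (intro ext)
  \<comment> \<open>A local conservation law in each cell; the two boundary conditions differ only
    in how it is summed.\<close>
  have balance: "energy_density rho1 B1 v1 i j k = energy_density rho0 B0 v0 i j k +
      ((X (i + 1) j k - X i j k) + (Y i (j + 1) k - Y i j k) + (Z i j (k + 1) - Z i j k))" for i j k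
    using ct_scheme_energy_increment[OF assms(7), of i j k]
      curl_inner_diff[of dx dy dz Bh i j k Om] assms(1-3)
    unfolding rho Bh_def[symmetric] Om_def[symmetric] X_def Y_def Z_def
    by (simp add: field_simps)
  have "(\<Sum>i\<in>{0..<Nx}. \<Sum>j\<in>{0..<Ny}. \<Sum>k\<in>{0..<Nz}. energy_density rho0 B0 v0 i j k) =
      (\<Sum>i\<in>{0..<Nx}. \<Sum>j\<in>{0..<Ny}. \<Sum>k\<in>{0..<Nz}. energy_density rho1 B1 v1 i j k)"
    if N: "Nx > 0" "Ny > 0" "Nz > 0"
      and per: "grid_periodic Nx Ny Nz B0" "grid_periodic Nx Ny Nz B1"
        "grid_periodic Nx Ny Nz v0" "grid_periodic Nx Ny Nz v1" for Nx Ny Nz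
  proof -
    have mid: "grid_periodic Nx Ny Nz (midpt F G)"
      if "grid_periodic Nx Ny Nz F" "grid_periodic Nx Ny Nz G" for F G
      unfolding midpt_def[abs_def] by (rule grid_periodic_map2[OF that])
    have Bh: "grid_periodic Nx Ny Nz Bh"
      unfolding Bh_def by (intro mid per)
    have Om: "grid_periodic Nx Ny Nz Om"
      unfolding Om_def grid_cross_def[abs_def] by (intro grid_periodic_map2[where h = cross3] Bh mid per)
    have "grid_periodic Nx Ny Nz X" "grid_periodic Nx Ny Nz Y" "grid_periodic Nx Ny Nz Z"
      using grid_periodic_interface_flux[OF Bh Om] unfolding flux_defs
      by (simp_all add: grid_periodic_def)
    \<comment> \<open>One instance of \<open>sum.distrib\<close> per nested sum splits off the old
      energy. Pinning its first summand keeps the three flux differences together, as in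
      \<open>sum_periodic_divergence\<close>.\<close>
    from sum_periodic_divergence[OF _ _ _ this] N show ?thesis
      unfolding balance sum.distrib[of "\<lambda>i. energy_density rho0 B0 v0 _ _ i"]
        sum.distrib[of "\<lambda>j. \<Sum>k\<in>_. energy_density rho0 B0 v0 _ j k"]
        sum.distrib[of "\<lambda>i. \<Sum>j\<in>_. \<Sum>k\<in>_. energy_density rho0 B0 v0 i j k"]
      by simp
  qed
  moreover have "(\<Sum>\<^sub>\<infinity>(i, j, k)\<in>UNIV. energy_density rho0 B0 v0 i j k) =
      (\<Sum>\<^sub>\<infinity>(i, j, k)\<in>UNIV. energy_density rho1 B1 v1 i j k)"
    if supp: "grid_compact_support B0" "grid_compact_support B1"
      "grid_compact_support v0" "grid_compact_support v1"
  proof -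
    have mid: "grid_compact_support (midpt F G)"
      if "grid_compact_support F" "grid_compact_support G" for F G
      unfolding midpt_def[abs_def] by (rule grid_compact_support_map2[OF that]) simp
    have Bh: "grid_compact_support Bh"
      unfolding Bh_def by (intro mid supp)
    have Om: "grid_compact_support Om"
      unfolding Om_def grid_cross_def[abs_def]
      by (intro grid_compact_support_map2[where h = cross3] Bh mid supp) simp
    have scaled: "grid_compact_support (\<lambda>i j k. r * F i j k $ n)"
      if "grid_compact_support F" for F :: "(real^3) grid_fun" and r n
      \<comment> \<open>A unary map treated as a binary one that ignores its second
        argument.\<close>
      using grid_compact_support_map2[OF that that, of "\<lambda>x y. r * x $ n"] by simp
    have "grid_compact_support X" "grid_compact_support Y" "grid_compact_support Z"
      unfolding flux_defs by (intro scaled grid_compact_support_interface_flux Bh Om)+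
    note zero = has_sum_shift_difference[OF this(1), of 1 0 0]
      has_sum_shift_difference[OF this(2), of 0 1 0] has_sum_shift_difference[OF this(3), of 0 0 1]
    \<comment> \<open>The density is positive on the whole grid; the energy has finite support
      because its two terms are quadratic in \<open>v0\<close> and \<open>B0\<close>.\<close>
    have "{(i, j, k). energy_density rho0 B0 v0 i j k \<noteq> 0} \<subseteq>
        {(i, j, k). B0 i j k \<noteq> 0} \<union> {(i, j, k). v0 i j k \<noteq> 0}"
      by (auto simp: energy_density_def)
    then have "grid_compact_support (energy_density rho0 B0 v0)"
      using supp(1,3) unfolding grid_compact_support_def by (meson finite_UnI finite_subset)
    from grid_compact_support_summable[OF this]
    have "((\<lambda>(i, j, k). energy_density rho0 B0 v0 i j k) has_sum
        (\<Sum>\<^sub>\<infinity>(i, j, k)\<in>UNIV. energy_density rho0 B0 v0 i j k)) UNIV"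
      by (rule has_sum_infsum)
    \<comment> \<open>Adding three families of sum 0 yields both the summability of the new energy
      and its value.\<close>
    from has_sum_add[OF this has_sum_add[OF has_sum_add[OF zero(1,2)] zero(3)]]
    have "((\<lambda>(i, j, k). energy_density rho1 B1 v1 i j k) has_sum
        (\<Sum>\<^sub>\<infinity>(i, j, k)\<in>UNIV. energy_density rho0 B0 v0 i j k)) UNIV"
      unfolding balance by (simp add: case_prod_unfold)
    then show ?thesis
      by (simp add: infsumI)
  qed
  ultimately show ?thesis
    by blast
qed

end
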